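(* For every Dyck path $\lambda$ and every $\sigma\in\mathscr{L}(P_\lambda)$, $\operatorname{dis}(\operatorname{DTR}(\lambda,\sigma))=\operatorname{des}(\sigma)$, where $\operatorname{des}(\sigma)=\#\{i<n:\sigma_i>\sigma_{i+1}\}$.
   Context: Dyck paths. A Dyck path of order $n$ is a lattice path from $(-n,0)$ to $(n,0)$ with steps $(+1,+1)$ (up step, U) and $(+1,-1)$ (down step, D) that never goes below the $x$-axis; we write $\rho(x)$ for its height at the integer $x$, and number its steps $1,\dots,2n$ from left to right. Column $s$ means the vertical line $x=s$. Skew shapes and Dyck tilings. A box is a square with vertices $(x,y),(x+1,y+1),(x,y+2),(x-1,y+1)$; $(x,y)$ is its lower corner and it lies in column $x$. For Dyck paths $\lambda,\mu$ of order $n$ with $\mu(x)\ge\lambda(x)$ for all $x$, the skew shape $\lambda/\mu$ is the set of boxes between $\lambda$ and $\mu$. A Dyck tile is a nonempty set of boxes, one in each of a set of consecutive columns, whose lower corners, read left to right, form a lattice path with steps $(+1,\pm1)$ whose first and last points have the same height and no point lower than them. A Dyck tiling of $\lambda/\mu$ is a partition of its boxes into Dyck tiles (lower path $\lambda$, upper path $\mu$, order $n$). For a tiling $T$ of $\lambda/\mu$, $\operatorname{dis}(T)$ is the number of $k$ such that step $k$ of $\lambda$ is a down step and step $k$ of $\mu$ is an up step. Chords and linear extensions. Each up step is matched with a down step as in balanced parentheses; such a pair is a chord. The chord poset $P_\lambda$: $c<c'$ iff both steps of $c'$ lie strictly between those of $c$. A natural labeling is a bijection $L:P_\lambda\to[n]$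 with $L(c)<L(c')$ whenever $c<c'$; $L_0$ numbers chords by the left-to-right order of their up steps; $\mathscr{L}(P_\lambda)=\{L_0\circ L^{-1}:L\text{ natural}\}\subseteq S_n$. Growth sequences. A growth sequence of length $n$ is $(p_1,\dots,p_n)$ with $0\le p_i\le 2(i-1)$. From it build $(\lambda,L)$: start with the empty word and for $i=1,\dots,n$ insert UD immediately after the first $p_i$ letters of the current word, labeling the new chord $i$. This is a bijection onto pairs (Dyck path $\lambda$ of order $n$, natural labeling of $P_\lambda$); let $p(\lambda,\sigma)$ be the growth sequence giving $(\lambda,L)$ with $L_0\circ L^{-1}=\sigma$. Spread. The spread at column $s$ of a path $\rho$ (a set of lattice points) is $\{(x-1,y):(x,y)\in\rho,x\le s\}\cup\{(x,y+1):(x,y)\in\rho,x=s\}\cup\{(x+1,y):(x,y)\in\rho,x\ge s\}$; the spread of a tile spreads its lower-corner path; the spread of a tiling spreads its lower path, upper path and all tiles. Special column. For a Dyck tiling $T$ with upper path $\mu$, column $s$ is eligible if $\mu$ has an up step ending in column $s$ and the point of $\mu$ at column $s$ is not the top corner of a one-box tile of $T$. The special column is the rightmost eligible column. Ribbon-grow and DTR. For a Dyck tiling $T$ of order $n$ and $-n\le s\le n$, let $T''$ be the spread of $T$ at $s$ with upper path $\mu''$ and special column $Q$. If $Q>s$, $\mathrm{rgrow}(T,s)$ is $T''$ together with, for each column $c$ with $s<c<Q$, the one-box tile with lower corner $(c,\mu''(c))$; otherwise $\mathrm{rgrow}(T,s)=T''$. $\operatorname{DTR}()$ is the empty tiling of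 order 0 and $\operatorname{DTR}(p_1,\dots,p_n)=\mathrm{rgrow}(\operatorname{DTR}(p_1,\dots,p_{n-1}),p_n-(n-1))$; $\operatorname{DTR}(\lambda,\sigma)=\operatorname{DTR}(p(\lambda,\sigma))$. *)

theory Defs
  imports "HOL-Combinatorics.Permutations"
begin

section \<open>Dyck paths\<close>

datatype step = U | D

definition height :: "step list \<Rightarrow> nat \<Rightarrow> int" where
  "height w k = int (count_list (take k w) U) - int (count_list (take k w) D)"

definition dyck_path :: "nat \<Rightarrow> step list \<Rightarrow> bool" where
  "dyck_path n w \<longleftrightarrow>
     length w = 2 * n \<and> (\<forall>k\<le>2 * n. 0 \<le> height w k) \<and> height w (2 * n) = 0"

type_synonym point = "int \<times> int"

definition path_points :: "nat \<Rightarrow> step list \<Rightarrow> point set" where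
  "path_points n w = {(int k - int n, height w k) | k. k \<le> 2 * n}"

text \<open>
  Steps of a point set are addressed by the column in which they end.
\<close>

definition up_step_to :: "point set \<Rightarrow> int \<Rightarrow> bool" where
  "up_step_to \<rho> x \<longleftrightarrow> (\<exists>y. (x - 1, y) \<in> \<rho> \<and> (x, y + 1) \<in> \<rho>)"

definition down_step_to :: "point set \<Rightarrow> int \<Rightarrow> bool" where
  "down_step_to \<rho> x \<longleftrightarrow> (\<exists>y. (x - 1, y) \<in> \<rho> \<and> (x, y - 1) \<in> \<rho>)"


section \<open>Dyck tilings\<close>

text \<open>
  A box is identified with its lower corner, so a set of boxes is a set of points, and
  the box \<open>(x, y)\<close> has top corner \<open>(x, y + 2)\<close>. The boxes between two paths are stacked
  from the lower path in steps of 2, whence the parity condition.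
\<close>

definition skew_shape :: "point set \<Rightarrow> point set \<Rightarrow> point set" where
  "skew_shape \<nu> \<mu> =
     {(x, y). \<exists>a b. (x, a) \<in> \<nu> \<and> (x, b) \<in> \<mu> \<and> a \<le> y \<and> y + 2 \<le> b \<and> even (y - a)}"

definition dyck_tile :: "point set \<Rightarrow> bool" where
  "dyck_tile t \<longleftrightarrow>
     (\<exists>a b h. a \<le> b \<and> t = {(x, h x) | x. a \<le> x \<and> x \<le> b} \<and>
        (\<forall>x. a \<le> x \<and> x < b \<longrightarrow> \<bar>h (x + 1) - h x\<bar> = 1) \<and>
        h a = h b \<and> (\<forall>x. a \<le> x \<and> x \<le> b \<longrightarrow> h a \<le> h x))"

record tiling =
  order :: nat
  lower :: "point set"
  upper :: "point set"
  tiles :: "point set set"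

text \<open>
  The operations on tilings below are total on the record type; the Dyck tilings are the
  records that satisfy the following predicate.
\<close>

definition dyck_tiling :: "tiling \<Rightarrow> bool" where
  "dyck_tiling T \<longleftrightarrow>
     (\<exists>\<nu> \<mu>. dyck_path (order T) \<nu> \<and> dyck_path (order T) \<mu> \<and>
        (\<forall>k\<le>2 * order T. height \<nu> k \<le> height \<mu> k) \<and>
        lower T = path_points (order T) \<nu> \<and> upper T = path_points (order T) \<mu>) \<and>
     (\<forall>t\<in>tiles T. dyck_tile t) \<and>
     \<Union> (tiles T) = skew_shape (lower T) (upper T) \<and>
     (\<forall>t\<in>tiles T. \<forall>t'\<in>tiles T. t \<noteq> t' \<longrightarrow> t \<inter> t' = {})"

text \<open>Step \<open>k\<close> of a path of order \<open>n\<close> ends in column \<open>k - n\<close>.\<close>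

definition dis :: "tiling \<Rightarrow> nat" where
  "dis T = card {k \<in> {1..2 * order T}.
     down_step_to (lower T) (int k - int (order T)) \<and>
     up_step_to (upper T) (int k - int (order T))}"


section \<open>Chords and linear extensions\<close>

text \<open>
  A chord is a pair of 0-based positions. The \<open>U\<close> at position \<open>i\<close> is matched with the
  \<open>D\<close> at position \<open>j\<close> iff the word strictly between them is balanced.
\<close>

type_synonym chord = "nat \<times> nat"

definition chords :: "step list \<Rightarrow> chord set" where
  "chords w = {(i, j). i < j \<and> j < length w \<and> w ! i = U \<and> w ! j = D \<and>
     (\<exists>m. dyck_path m (take (j - Suc i) (drop (Suc i) w)))}"

definition chord_less :: "chord \<Rightarrow> chord \<Rightarrow> bool" where
  "chord_less c c' \<longleftrightarrow> fst c < fst c' \<and> snd c' < snd c"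

definition natural_labeling :: "nat \<Rightarrow> step list \<Rightarrow> (chord \<Rightarrow> nat) \<Rightarrow> bool" where
  "natural_labeling n w L \<longleftrightarrow>
     bij_betw L (chords w) {1..n} \<and>
     (\<forall>c\<in>chords w. \<forall>c'\<in>chords w. chord_less c c' \<longrightarrow> L c < L c')"

definition L0 :: "step list \<Rightarrow> chord \<Rightarrow> nat" where
  "L0 w c = card {c' \<in> chords w. fst c' \<le> fst c}"

text \<open>
  \<open>L\<^sub>0 \<circ> L\<^sup>-\<^sup>1\<close> as a permutation of \<open>{1..n}\<close>, extended by the identity as for
  \<^const>\<open>permutes\<close>.
\<close>

definition labeling_perm :: "nat \<Rightarrow> step list \<Rightarrow> (chord \<Rightarrow> nat) \<Rightarrow> nat \<Rightarrow> nat" where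
  "labeling_perm n w L i =
     (if i \<in> {1..n} then L0 w (inv_into (chords w) L i) else i)"

definition linear_extensions :: "nat \<Rightarrow> step list \<Rightarrow> (nat \<Rightarrow> nat) set" where
  "linear_extensions n w = {labeling_perm n w L | L. natural_labeling n w L}"

definition des :: "nat \<Rightarrow> (nat \<Rightarrow> nat) \<Rightarrow> nat" where
  "des n \<sigma> = card {i. 1 \<le> i \<and> i < n \<and> \<sigma> i > \<sigma> (i + 1)}"


section \<open>Growth sequences\<close>

text \<open>
  \<open>p ! i\<close> is the entry \<open>p\<^bsub>i+1\<^esub>\<close>.
\<close>

definition growth_sequence :: "nat \<Rightarrow> nat list \<Rightarrow> bool" where
  "growth_sequence n p \<longleftrightarrow> length p = n \<and> (\<forall>i<n. p ! i \<le> 2 * i)"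

text \<open>
  Every letter carries the label of its chord. Inserting \<open>UD\<close> does not change the
  matching of the other letters, so these labels stay attached to their chords.
\<close>

primrec grow_upto :: "nat list \<Rightarrow> nat \<Rightarrow> (step \<times> nat) list" where
  "grow_upto p 0 = []"
| "grow_upto p (Suc i) =
     take (p ! i) (grow_upto p i) @ [(U, Suc i), (D, Suc i)] @ drop (p ! i) (grow_upto p i)"

definition grow_path :: "nat list \<Rightarrow> step list" where
  "grow_path p = map fst (grow_upto p (length p))"

definition grow_labeling :: "nat list \<Rightarrow> chord \<Rightarrow> nat" where
  "grow_labeling p c = snd (grow_upto p (length p) ! fst c)"

definition growth_of :: "nat \<Rightarrow> step list \<Rightarrow> (nat \<Rightarrow> nat) \<Rightarrow> nat list" where
  "growth_of n w \<sigma> = (THE p. growth_sequence n p \<and> grow_path p = w \<and>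
     labeling_perm n w (grow_labeling p) = \<sigma>)"


section \<open>Spread, ribbon growth and DTR\<close>

definition spread_path :: "int \<Rightarrow> point set \<Rightarrow> point set" where
  "spread_path s \<rho> =
     {(x - 1, y) | x y. (x, y) \<in> \<rho> \<and> x \<le> s} \<union>
     {(x, y + 1) | x y. (x, y) \<in> \<rho> \<and> x = s} \<union>
     {(x + 1, y) | x y. (x, y) \<in> \<rho> \<and> s \<le> x}"

definition spread :: "tiling \<Rightarrow> int \<Rightarrow> tiling" where
  "spread T s =
     \<lparr>order = order T + 1,
      lower = spread_path s (lower T),
      upper = spread_path s (upper T),
      tiles = spread_path s ` tiles T\<rparr>"

definition eligible :: "tiling \<Rightarrow> int \<Rightarrow> bool" where
  "eligible T c \<longleftrightarrow> up_step_to (upper T) c \<and>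
     \<not> (\<exists>y. (c, y + 2) \<in> upper T \<and> {(c, y)} \<in> tiles T)"

text \<open>
  For a spread tiling the maximum exists: \<open>spread T s\<close> has a peak of the upper path but no
  one-box tile in column \<open>s\<close>, so \<open>s\<close> is eligible.
\<close>

definition special_column :: "tiling \<Rightarrow> int" where
  "special_column T = Max {c. eligible T c}"

text \<open>
  Placing a box on the point \<open>(c, y)\<close> of the upper path moves that point to the top
  corner \<open>(c, y + 2)\<close>.
\<close>

definition add_ribbon :: "tiling \<Rightarrow> int set \<Rightarrow> tiling" where
  "add_ribbon T C =
     \<lparr>order = order T,
      lower = lower T,
      upper = {(c, y) | c y. (c, y) \<in> upper T \<and> c \<notin> C} \<union>
              {(c, y + 2) | c y. (c, y) \<in> upper T \<and> c \<in> C},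
      tiles = tiles T \<union> {{(c, y)} | c y. (c, y) \<in> upper T \<and> c \<in> C}\<rparr>"

definition rgrow :: "tiling \<Rightarrow> int \<Rightarrow> tiling" where
  "rgrow T s =
     (let T'' = spread T s; Q = special_column T''
      in if Q > s then add_ribbon T'' {s<..<Q} else T'')"

definition empty_tiling :: tiling where
  "empty_tiling = \<lparr>order = 0, lower = {(0, 0)}, upper = {(0, 0)}, tiles = {}\<rparr>"

primrec DTR_upto :: "nat list \<Rightarrow> nat \<Rightarrow> tiling" where
  "DTR_upto p 0 = empty_tiling"
| "DTR_upto p (Suc i) = rgrow (DTR_upto p i) (int (p ! i) - int i)"

definition DTR_growth :: "nat list \<Rightarrow> tiling" where
  "DTR_growth p = DTR_upto p (length p)"

definition DTR :: "nat \<Rightarrow> step list \<Rightarrow> (nat \<Rightarrow> nat) \<Rightarrow> tiling" where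
  "DTR n w \<sigma> = DTR_growth (growth_of n w \<sigma>)"

end

theory Submission
  imports Defs
begin

text \<open>
  Both statistics count the indices \<open>i\<close> with \<open>p\<^bsub>i+1\<^esub> \<le> p\<^bsub>i\<^esub>\<close>, where \<open>p\<close> is the growth
  sequence of \<open>(\<lambda>, \<sigma>)\<close>. For the descents this holds because the chord labeled \<open>i + 1\<close> is
  inserted to the left of the chord labeled \<open>i\<close> exactly in this case, and later insertions
  preserve the order of up steps. For the disagreements, growing at column \<open>s\<close> leaves \<open>s\<close> as
  the special column, so the next ribbon, grown at \<open>s'\<close>, is nonempty exactly if \<open>s' < s\<close>. A
  nonempty ribbon turns the down step of the upper path next to \<open>s'\<close> into an up step, above a
  down step of the lower path; at its other end it turns an up step into a down step, above an
  up step of the lower path that was created at \<open>s\<close>. Hence it adds exactly one disagreement.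
\<close>

section \<open>Disagreements under ribbon growth\<close>

text \<open>Height functions turn steps into equations between neighbouring values, and spreads and
  ribbons into explicit changes of the function.\<close>

definition path_graph :: "nat \<Rightarrow> (int \<Rightarrow> int) \<Rightarrow> point set" where
  "path_graph n f = {(x, f x) | x. - int n \<le> x \<and> x \<le> int n}"

lemma mem_path_graph: "(x, y) \<in> path_graph n f \<longleftrightarrow> - int n \<le> x \<and> x \<le> int n \<and> y = f x"
  by (auto simp: path_graph_def)

lemma up_step_to_graph:
  "up_step_to (path_graph n f) c \<longleftrightarrow> - int n < c \<and> c \<le> int n \<and> f c = f (c - 1) + 1"
  by (auto simp: up_step_to_def mem_path_graph)

lemma down_step_to_graph:
  "down_step_to (path_graph n f) c \<longleftrightarrow> - int n < c \<and> c \<le> int n \<and> f c = f (c - 1) - 1"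
  by (auto simp: down_step_to_def mem_path_graph)

definition spread_fun :: "int \<Rightarrow> (int \<Rightarrow> int) \<Rightarrow> int \<Rightarrow> int" where
  "spread_fun s f x = (if x < s then f (x + 1) else if x = s then f s + 1 else f (x - 1))"

lemma mem_spread_path:
  "(x, y) \<in> spread_path s \<rho> \<longleftrightarrow>
     (x < s \<and> (x + 1, y) \<in> \<rho>) \<or> (x = s \<and> (x, y - 1) \<in> \<rho>) \<or> (s < x \<and> (x - 1, y) \<in> \<rho>)"
proof
  assume "(x, y) \<in> spread_path s \<rho>"
  then show "(x < s \<and> (x + 1, y) \<in> \<rho>) \<or> (x = s \<and> (x, y - 1) \<in> \<rho>) \<or> (s < x \<and> (x - 1, y) \<in> \<rho>)"
    by (auto simp: spread_path_def)
next
  assume "(x < s \<and> (x + 1, y) \<in> \<rho>) \<or> (x = s \<and> (x, y - 1) \<in> \<rho>) \<or> (s < x \<and> (x - 1, y) \<in> \<rho>)"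
  then show "(x, y) \<in> spread_path s \<rho>"
    unfolding spread_path_def
    by (elim disjE; intro UnI1 UnI2; force)
qed

lemma spread_path_graph:
  assumes "- int n \<le> s" "s \<le> int n"
  shows "spread_path s (path_graph n f) = path_graph (Suc n) (spread_fun s f)"
  using assms by (auto simp: mem_spread_path mem_path_graph spread_fun_def)

text \<open>A point of \<open>t\<close> in column \<open>s\<close> would leave points in both
  columns \<open>s - 1\<close> and \<open>s + 1\<close>, and a point left of \<open>s\<close> moves
  further left, away from \<open>c\<close>. So \<open>t\<close> lies right of \<open>s\<close>,
  where the spread is a mere shift.\<close>

lemma singleton_eq_spread_path:
  assumes "{(c, y)} = spread_path s t" "s \<le> c"
  shows "s < c - 1 \<and> t = {(c - 1, y)}"
proof -
  have mem: "(x, z) = (c, y) \<longleftrightarrow> (x, z) \<in> spread_path s t" for x z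
    using assms(1) by auto
  have ns: "(s, z) \<notin> t" for z
    using mem[of "s - 1" z] mem[of "s + 1" z] by (auto simp: mem_spread_path)
  have lt: "(x, z) \<notin> t" if "x < s" for x z
    using mem[of "x - 1" z] that assms(2) by (auto simp: mem_spread_path)
  have gt: "(x, z) \<in> t \<longleftrightarrow> x = c - 1 \<and> z = y" if "s < x" for x z
    using mem[of "x + 1" z] that by (auto simp: mem_spread_path)
  have "(c, y) \<in> spread_path s t" using mem by blast
  then have m: "(c - 1, y) \<in> t" using assms(2) ns by (auto simp: mem_spread_path)
  with ns lt have "s < c - 1" by (metis linorder_neqE)
  moreover have "t = {(c - 1, y)}"
    using ns lt gt m by (auto, (metis linorder_neqE)+)
  ultimately show ?thesis by simp
qed

lemma spread_path_singleton: "s < x \<Longrightarrow> spread_path s {(x, y)} = {(x + 1, y)}"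
  by (auto simp: mem_spread_path)

section \<open>Eligible columns after a spread\<close>

text \<open>Right of \<open>s\<close> the path and the one-box tiles are shifted by one column. The
  exception is column \<open>s + 1\<close>, where the down step of the new peak ends.\<close>

lemma eligible_spread_right:
  assumes "upper T = path_graph n g" "- int n \<le> s" "s \<le> int n" "s < c"
  shows "eligible (spread T s) c \<longleftrightarrow> s < c - 1 \<and> eligible T (c - 1)"
proof -
  have up: "up_step_to (upper (spread T s)) c \<longleftrightarrow> s < c - 1 \<and> up_step_to (upper T) (c - 1)"
    using assms by (auto simp: spread_def spread_path_graph up_step_to_graph spread_fun_def)
  have tile: "{(c, y)} \<in> tiles (spread T s) \<longleftrightarrow> {(c - 1, y)} \<in> tiles T" if "s < c - 1" for y
  proof
    assume "{(c, y)} \<in> tiles (spread T s)"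
    then show "{(c - 1, y)} \<in> tiles T"
      using singleton_eq_spread_path assms(4) by (fastforce simp: spread_def)
  next
    assume "{(c - 1, y)} \<in> tiles T"
    then show "{(c, y)} \<in> tiles (spread T s)"
      using spread_path_singleton[OF that, of y] by (force simp: spread_def)
  qed
  have top: "(c, y) \<in> upper (spread T s) \<longleftrightarrow> (c - 1, y) \<in> upper T" for y
    using assms(4) by (simp add: spread_def mem_spread_path)
  show ?thesis
    unfolding eligible_def up top using tile by auto
qed

lemma no_box_at_spread_column: "{(s, y)} \<notin> tiles (spread T s)"
  using singleton_eq_spread_path[of s y s] by (auto simp: spread_def)

lemma eligible_spread_self:
  assumes "upper T = path_graph n g" "- int n \<le> s" "s \<le> int n"
  shows "eligible (spread T s) s"
  using assms no_box_at_spread_column[of s _ T]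
  by (simp add: eligible_def spread_def spread_path_graph up_step_to_graph spread_fun_def)

text \<open>\<open>Max\<close> is meaningful here because up steps of the upper path end in only
  finitely many columns.\<close>

lemma special_column_eqI:
  assumes "upper T = path_graph n g" "eligible T s" "\<And>c. s < c \<Longrightarrow> \<not> eligible T c"
  shows "special_column T = s"
proof -
  have "{c. eligible T c} \<subseteq> {- int n<..int n}"
    using assms(1) by (auto simp: eligible_def up_step_to_graph)
  then have "finite {c. eligible T c}"
    by (rule finite_subset) simp
  then show ?thesis
    unfolding special_column_def using assms(2,3)
    by (intro Max_eqI) (auto simp: leI dest: assms(3) intro: ccontr)
qed

section \<open>Disagreements under a spread\<close>

text \<open>Disagreements are recorded by the column in which the step ends, since spreads and
  ribbons act on columns; step \<open>k\<close> corresponds to column \<open>k - n\<close>.\<close>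

definition dis_columns :: "nat \<Rightarrow> (int \<Rightarrow> int) \<Rightarrow> (int \<Rightarrow> int) \<Rightarrow> int set" where
  "dis_columns n f g =
     {c. - int n < c \<and> c \<le> int n \<and> f c = f (c - 1) - 1 \<and> g c = g (c - 1) + 1}"

lemma finite_dis_columns: "finite (dis_columns n f g)"
  by (rule finite_subset[of _ "{- int n<..int n}"]) (auto simp: dis_columns_def)

lemma dis_eq_card_columns:
  assumes "lower T = path_graph (order T) f" "upper T = path_graph (order T) g"
  shows "dis T = card (dis_columns (order T) f g)"
proof -
  have "bij_betw (\<lambda>k. int k - int (order T))
    {k \<in> {1..2 * order T}. down_step_to (lower T) (int k - int (order T)) \<and>
       up_step_to (upper T) (int k - int (order T))} (dis_columns (order T) f g)"
    by (rule bij_betw_byWitness[where f' = "\<lambda>c. nat (c + int (order T))"])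
      (auto simp: dis_columns_def assms up_step_to_graph down_step_to_graph)
  then show ?thesis
    unfolding dis_def by (rule bij_betw_same_card)
qed

text \<open>In columns \<open>s\<close> and \<open>s + 1\<close> both paths run over their new peak,
  up and then down, so they do not disagree there. All other steps are old ones, shifted.\<close>

lemma mem_dis_columns_spread:
  assumes "- int n \<le> s" "s \<le> int n"
  shows "c \<in> dis_columns (Suc n) (spread_fun s f) (spread_fun s g) \<longleftrightarrow>
    (c < s \<and> c + 1 \<in> dis_columns n f g) \<or> (s + 1 < c \<and> c - 1 \<in> dis_columns n f g)"
proof -
  consider "c < s" | "c = s" | "c = s + 1" | "s + 1 < c" by linarith
  then show ?thesis
    by cases (use assms in \<open>auto simp: dis_columns_def spread_fun_def\<close>)
qed

lemma card_dis_columns_spread: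
  assumes "- int n \<le> s" "s \<le> int n"
  shows "card (dis_columns (Suc n) (spread_fun s f) (spread_fun s g)) = card (dis_columns n f g)"
proof -
  \<comment> \<open>The step ending in column \<open>s\<close> lies left of that column and moves
    left, hence \<open>c \<le> s\<close>. The inverse may test \<open>c < s\<close>, as columns
    \<open>s\<close> and \<open>s + 1\<close> are missed.\<close>
  have "bij_betw (\<lambda>c. if c \<le> s then c - 1 else c + 1)
    (dis_columns n f g) (dis_columns (Suc n) (spread_fun s f) (spread_fun s g))"
    by (rule bij_betw_byWitness[where f' = "\<lambda>c. if c < s then c + 1 else c - 1"])
      (auto simp: mem_dis_columns_spread[OF assms])
  then show ?thesis
    by (simp add: bij_betw_same_card)
qed

text \<open>
  The state of the growth process after a ribbon has been grown at column \<open>s\<close>. The up step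
  of the lower path is what keeps a later ribbon, which turns the up step of the upper path
  ending in the special column into a down step, from destroying a disagreement.
\<close>

definition special_at :: "tiling \<Rightarrow> int \<Rightarrow> bool" where
  "special_at T s \<longleftrightarrow>
     (\<exists>f g. lower T = path_graph (order T) f \<and> upper T = path_graph (order T) g) \<and>
     up_step_to (lower T) s \<and> eligible T s \<and> (\<forall>c>s. \<not> eligible T c)"

text \<open>With nothing eligible right of \<open>s\<close>, the new peak makes \<open>s\<close> the
  special column of the spread, so the ribbon is empty.\<close>

lemma rgrow_no_ribbon:
  assumes graphs: "lower T = path_graph (order T) f" "upper T = path_graph (order T) g"
    and s: "- int (order T) \<le> s" "s \<le> int (order T)"
    and none: "\<And>c. s < c \<Longrightarrow> \<not> eligible T c"
  shows "special_at (rgrow T s) s \<and> order (rgrow T s) = Suc (order T) \<and> dis (rgrow T s) = dis T"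
proof -
  define S where "S = spread T s"
  have S: "order S = Suc (order T)" "lower S = path_graph (Suc (order T)) (spread_fun s f)"
    "upper S = path_graph (Suc (order T)) (spread_fun s g)"
    using graphs s by (simp_all add: S_def spread_def spread_path_graph)
  have el: "eligible S s" "\<And>c. s < c \<Longrightarrow> \<not> eligible S c"
    using eligible_spread_self[OF graphs(2) s] eligible_spread_right[OF graphs(2) s] none
    by (auto simp: S_def)
  have "special_column S = s"
    using special_column_eqI[OF S(3) el] .
  then have "rgrow T s = S"
    by (simp add: rgrow_def S_def)
  moreover have "up_step_to (lower S) s"
    using s by (simp add: S up_step_to_graph spread_fun_def)
  moreover have "dis S = dis T"
    using dis_eq_card_columns[OF graphs] dis_eq_card_columns[of S] S card_dis_columns_spread[OF s]
    by simp
  ultimately show ?thesis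
    using S el by (auto simp: special_at_def)
qed

text \<open>The spread keeps the old special column to the right of \<open>s\<close>, so the ribbon
  is nonempty. It blocks every eligible column right of \<open>s\<close>, and only its left end
  changes the set of disagreements.\<close>

lemma rgrow_ribbon:
  assumes T: "special_at T q" and s: "- int (order T) \<le> s" and "s < q"
  shows "special_at (rgrow T s) s \<and> order (rgrow T s) = Suc (order T) \<and>
    dis (rgrow T s) = Suc (dis T)"
proof -
  from T obtain f g where graphs: "lower T = path_graph (order T) f"
      "upper T = path_graph (order T) g"
    by (auto simp: special_at_def)
  have q: "- int (order T) < q" "q \<le> int (order T)" "f q = f (q - 1) + 1" "g q = g (q - 1) + 1"
    using T graphs by (auto simp: special_at_def eligible_def up_step_to_graph)
  have s': "s \<le> int (order T)" using q assms(3) by simp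
  define S where "S = spread T s"
  \<comment> \<open>The spread moves the special column from \<open>q\<close> to
    \<open>q + 1\<close>, so the ribbon occupies the columns \<open>s + 1\<close> to
    \<open>q\<close>.\<close>
  define R where "R = add_ribbon S {s<..<q + 1}"
  define g' where "g' = (\<lambda>x. spread_fun s g x + (if s < x \<and> x \<le> q then 2 else 0))"
  have S: "order S = Suc (order T)" "lower S = path_graph (Suc (order T)) (spread_fun s f)"
    "upper S = path_graph (Suc (order T)) (spread_fun s g)"
    using graphs s s' by (simp_all add: S_def spread_def spread_path_graph)
  have elS: "eligible S (q + 1)" "\<And>c. q + 1 < c \<Longrightarrow> \<not> eligible S c"
    using eligible_spread_right[OF graphs(2) s s'] T \<open>s < q\<close>
    by (auto simp: S_def special_at_def)
  have "special_column S = q + 1"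
    using special_column_eqI[OF S(3) elS] .
  then have rg: "rgrow T s = R"
    using \<open>s < q\<close> by (simp add: rgrow_def R_def S_def)
  have R: "order R = Suc (order T)" "lower R = path_graph (Suc (order T)) (spread_fun s f)"
    "tiles R = tiles S \<union> {{(c, y)} | c y. (c, y) \<in> upper S \<and> s < c \<and> c \<le> q}"
    by (auto simp: R_def add_ribbon_def S)
  have upR: "upper R = path_graph (Suc (order T)) g'"
    by (auto simp: R_def add_ribbon_def S mem_path_graph g'_def)
  have "eligible R s"
    using no_box_at_spread_column[of s _ T] eligible_spread_self[OF graphs(2) s s']
    by (auto simp: eligible_def R upR S_def[symmetric] S up_step_to_graph g'_def)
  moreover have "\<not> eligible R c" if "s < c" for c
  proof -
    consider "c \<le> q" | "c = q + 1" | "q + 1 < c" by linarith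
    then show ?thesis
    proof cases
      case 1
      \<comment> \<open>The ribbon box placed in column \<open>c\<close> has its top corner on the
        new upper path.\<close>
      have "{(c, spread_fun s g c)} \<in> tiles R"
        if "up_step_to (upper R) c"
        using 1 \<open>s < c\<close> that unfolding R by (auto simp: upR S mem_path_graph up_step_to_graph)
      then show ?thesis
        using 1 \<open>s < c\<close> by (auto simp: eligible_def upR mem_path_graph up_step_to_graph g'_def)
    next
      case 2
      then show ?thesis
        \<comment> \<open>The point in column \<open>q\<close> is raised by 2 and the one in column
          \<open>q + 1\<close> is not, so the up step between them becomes a down step.\<close>
        using \<open>s < q\<close> q by (simp add: eligible_def upR up_step_to_graph g'_def spread_fun_def)
    next
      case 3
      then show ?thesis
        using elS(2)[OF 3] unfolding eligible_def R
        by (auto simp: upR S up_step_to_graph mem_path_graph g'_def)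
    qed
  qed
  moreover have "up_step_to (lower R) s"
    using s s' by (simp add: R up_step_to_graph spread_fun_def)
  moreover have "dis R = Suc (dis T)"
  proof -
    \<comment> \<open>In column \<open>s + 1\<close> the lower path descends from its new peak while
      the upper path now rises. In column \<open>q + 1\<close> the lower path rises, so the up step
      lost there was no disagreement. Elsewhere no step changes.\<close>
    have "dis_columns (Suc (order T)) (spread_fun s f) g' =
        insert (s + 1) (dis_columns (Suc (order T)) (spread_fun s f) (spread_fun s g))"
      (is "?A = ?B")
    proof (rule set_eqI)
      fix c
      consider "c \<le> s" | "c = s + 1" | "s + 1 < c" "c \<le> q" | "c = q + 1" | "q + 1 < c"
        by linarith
      then show "c \<in> ?A \<longleftrightarrow> c \<in> ?B"
        by cases (use s \<open>s < q\<close> q in \<open>auto simp: dis_columns_def g'_def spread_fun_def\<close>)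
    qed
    moreover have "s + 1 \<notin> dis_columns (Suc (order T)) (spread_fun s f) (spread_fun s g)"
      by (simp add: dis_columns_def spread_fun_def)
    ultimately have "card (dis_columns (Suc (order T)) (spread_fun s f) g') =
        Suc (card (dis_columns (order T) f g))"
      using card_dis_columns_spread[OF s s', of f g] by (simp add: finite_dis_columns)
    then show ?thesis
      using dis_eq_card_columns[OF graphs] dis_eq_card_columns[of R] R upR by simp
  qed
  ultimately show ?thesis
    using R upR by (auto simp: rg special_at_def)
qed

section \<open>Disagreements of the fully grown tiling\<close>

lemma special_at_DTR_upto:
  assumes "\<And>j. j \<le> i \<Longrightarrow> p ! j \<le> 2 * j"
  shows "special_at (DTR_upto p (Suc i)) (int (p ! i) - int i) \<and>
    order (DTR_upto p (Suc i)) = Suc i \<and>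
    dis (DTR_upto p (Suc i)) = card {j. j < i \<and> p ! Suc j \<le> p ! j}"
  using assms
proof (induction i)
  case 0
  have "lower empty_tiling = path_graph (order empty_tiling) (\<lambda>_. 0)"
    "upper empty_tiling = path_graph (order empty_tiling) (\<lambda>_. 0)"
    by (auto simp: empty_tiling_def path_graph_def)
  moreover have "\<not> eligible empty_tiling c" for c
    by (simp add: eligible_def empty_tiling_def up_step_to_def)
  moreover have "dis empty_tiling = 0"
    by (simp add: dis_def empty_tiling_def)
  moreover have "p ! 0 = 0" using 0[of 0] by simp
  ultimately show ?case
    using rgrow_no_ribbon[of empty_tiling "\<lambda>_. 0" "\<lambda>_. 0" 0]
    by (simp add: empty_tiling_def)
next
  case (Suc i)
  define T where "T = DTR_upto p (Suc i)"
  define s where "s = int (p ! Suc i) - int (Suc i)"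
  have T: "special_at T (int (p ! i) - int i)" "order T = Suc i"
    "dis T = card {j. j < i \<and> p ! Suc j \<le> p ! j}"
    using Suc by (simp_all add: T_def)
  have s: "- int (order T) \<le> s" "s \<le> int (order T)"
    using Suc.prems[of "Suc i"] T by (simp_all add: s_def)
  have next_T: "DTR_upto p (Suc (Suc i)) = rgrow T s"
    by (simp add: T_def s_def)
  show ?case
  \<comment> \<open>The columns are \<open>p ! i - i\<close> and \<open>p ! Suc i - Suc i\<close>.
    The extra 1 subtracted turns the strict comparison of columns into the weak one of
    entries.\<close>
  proof (cases "p ! Suc i \<le> p ! i")
    case True
    then have "{j. j < Suc i \<and> p ! Suc j \<le> p ! j} = insert i {j. j < i \<and> p ! Suc j \<le> p ! j}"
      by (auto simp: less_Suc_eq)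
    then show ?thesis
      unfolding next_T using rgrow_ribbon[OF T(1) s(1)] True T by (simp add: s_def)
  next
    case False
    then have "{j. j < Suc i \<and> p ! Suc j \<le> p ! j} = {j. j < i \<and> p ! Suc j \<le> p ! j}"
      by (auto simp: less_Suc_eq)
    moreover obtain f g where "lower T = path_graph (order T) f" "upper T = path_graph (order T) g"
      using T by (auto simp: special_at_def)
    moreover have "\<not> eligible T c" if "s < c" for c
      using T(1) that False by (auto simp: special_at_def s_def)
    ultimately show ?thesis
      unfolding next_T using rgrow_no_ribbon[of T f g s] s T by (simp add: s_def)
  qed
qed

lemma dis_DTR_growth:
  assumes "growth_sequence n p"
  shows "dis (DTR_growth p) = card {j. Suc j < n \<and> p ! Suc j \<le> p ! j}"
proof (cases n)
  case 0
  then show ?thesis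
    using assms by (simp add: growth_sequence_def DTR_growth_def dis_def empty_tiling_def)
next
  case (Suc i)
  then show ?thesis
    using assms special_at_DTR_upto[of i p] by (simp add: growth_sequence_def DTR_growth_def)
qed

section \<open>Balanced words and chords\<close>

text \<open>The Dyck condition for a word read from starting height \<open>h\<close>, in a form
  suited to induction on words. A natural number as height makes falling below the axis the case of
  a \<open>D\<close> at height 0.\<close>

primrec balanced_from :: "nat \<Rightarrow> step list \<Rightarrow> bool" where
  "balanced_from h [] \<longleftrightarrow> h = 0"
| "balanced_from h (x # w) \<longleftrightarrow>
     (case x of U \<Rightarrow> balanced_from (Suc h) w | D \<Rightarrow> 0 < h \<and> balanced_from (h - 1) w)"

lemma height_0: "height w 0 = 0"
  by (simp add: height_def)

lemma height_Cons_Suc: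
  "height (x # w) (Suc k) = (case x of U \<Rightarrow> 1 | D \<Rightarrow> - 1) + height w k"
  by (cases x) (simp_all add: height_def)

lemma all_le_Suc_iff: "(\<forall>k\<le>Suc n. P k) \<longleftrightarrow> P 0 \<and> (\<forall>k\<le>n. P (Suc k))"
  by (metis Suc_le_mono le0 not0_implies_Suc)

lemma balanced_from_iff_height:
  "balanced_from h w \<longleftrightarrow>
     (\<forall>k\<le>length w. 0 \<le> int h + height w k) \<and> int h + height w (length w) = 0"
proof (induction w arbitrary: h)
  case Nil
  then show ?case by (auto simp: height_0)
next
  case (Cons x w)
  show ?case
  proof (cases x)
    case U
    then show ?thesis
      by (simp add: Cons.IH all_le_Suc_iff height_0 height_Cons_Suc add.assoc add.commute)
        (simp add: algebra_simps)
  next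
    case D
    have shift: "int (Suc m) + (- 1 + z) = int m + z" for m z by simp
    show ?thesis
    proof (cases h)
      case 0
      have "\<not> (\<forall>k\<le>Suc (length w). 0 \<le> height (x # w) k)"
        using D by (auto simp: all_le_Suc_iff height_Cons_Suc height_0 intro!: exI[of _ 0])
      with D 0 show ?thesis by simp
    next
      case (Suc m)
      then show ?thesis
        unfolding list.size add_0_right add_Suc_right all_le_Suc_iff height_Cons_Suc height_0
        by (simp only: D step.case shift balanced_from.simps Cons.IH) simp
    qed
  qed
qed

lemma length_eq_count_steps: "length w = count_list w U + count_list w D"
proof (induction w)
  case (Cons x w)
  then show ?case by (cases x) simp_all
qed simp

lemma dyck_path_iff_balanced: "dyck_path n w \<longleftrightarrow> length w = 2 * n \<and> balanced_from 0 w"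
  by (auto simp: dyck_path_def balanced_from_iff_height)

text \<open>A balanced word has as many \<open>U\<close> as \<open>D\<close>, so its length is even
  and the order exists.\<close>

lemma ex_dyck_path_iff_balanced: "(\<exists>m. dyck_path m w) \<longleftrightarrow> balanced_from 0 w"
proof
  assume b: "balanced_from 0 w"
  then have "count_list w U = count_list w D"
    by (simp add: balanced_from_iff_height height_def)
  then have "length w = 2 * count_list w U"
    using length_eq_count_steps[of w] by simp
  with b show "\<exists>m. dyck_path m w"
    by (auto simp: dyck_path_iff_balanced)
qed (auto simp: dyck_path_iff_balanced)

lemma mem_chords:
  "(i, j) \<in> chords w \<longleftrightarrow> i < j \<and> j < length w \<and> w ! i = U \<and> w ! j = D \<and>
     balanced_from 0 (take (j - Suc i) (drop (Suc i) w))"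
  by (simp add: chords_def ex_dyck_path_iff_balanced)

lemma finite_chords: "finite (chords w)"
  by (rule finite_subset[of _ "{..<length w} \<times> {..<length w}"]) (auto simp: mem_chords)

lemma balanced_from_insert_UD:
  "balanced_from h (u @ U # D # v) \<longleftrightarrow> balanced_from h (u @ v)"
  by (induction u arbitrary: h) (auto split: step.split)

lemma not_balanced_from_snoc_U: "\<not> balanced_from h (u @ [U])"
  by (induction u arbitrary: h) (auto split: step.split)

text \<open>A word ending at height 0 must descend after its initial \<open>U\<close>, and its first
  \<open>D\<close> directly follows a \<open>U\<close>.\<close>

lemma balanced_from_Cons_U_peak:
  "balanced_from h (U # w) \<Longrightarrow> \<exists>u v. U # w = u @ U # D # v"
proof (induction w arbitrary: h)
  case (Cons x w)
  show ?case
  proof (cases x)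
    case U
    then obtain u v where "x # w = u @ U # D # v"
      using Cons.IH[of "Suc h"] Cons.prems by auto
    then have "U # x # w = (U # u) @ U # D # v" by simp
    then show ?thesis by blast
  next
    case D
    then have "U # x # w = [] @ U # D # w" by simp
    then show ?thesis by blast
  qed
qed simp

lemma balanced_peak:
  assumes "balanced_from 0 w" "w \<noteq> []"
  obtains u v where "w = u @ U # D # v"
proof (cases w)
  case (Cons x w')
  then have "x = U" using assms by (cases x) auto
  then show ?thesis using balanced_from_Cons_U_peak[of 0 w'] assms Cons that by auto
qed (use assms in simp)


section \<open>Inserting a peak\<close>

text \<open>Polymorphic in the letters, so that it applies to step words and to the labeled words of
  the growth process alike.\<close>

definition insert_pair :: "nat \<Rightarrow> 'a \<Rightarrow> 'a \<Rightarrow> 'a list \<Rightarrow> 'a list" where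
  "insert_pair a x y w = take a w @ x # y # drop a w"

text \<open>The position, after an insertion at \<open>a\<close>, of the letter that was at position
  \<open>i\<close>.\<close>

definition skip_pair :: "nat \<Rightarrow> nat \<Rightarrow> nat" where
  "skip_pair a i = (if i < a then i else i + 2)"

definition skip_chord :: "nat \<Rightarrow> chord \<Rightarrow> chord" where
  "skip_chord a = map_prod (skip_pair a) (skip_pair a)"

lemma length_insert_pair: "length (insert_pair a x y w) = length w + 2"
  by (simp add: insert_pair_def)

lemma nth_insert_pair:
  assumes "a \<le> length w"
  shows "insert_pair a x y w ! a = x" "insert_pair a x y w ! Suc a = y"
    "i < length w \<Longrightarrow> insert_pair a x y w ! skip_pair a i = w ! i"
  using assms by (simp_all add: insert_pair_def skip_pair_def nth_append)

lemma skip_pair_less_iff: "skip_pair a i < skip_pair a j \<longleftrightarrow> i < j"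
  by (auto simp: skip_pair_def)

lemma skip_pair_eq_iff: "skip_pair a i = skip_pair a j \<longleftrightarrow> i = j"
  by (auto simp: skip_pair_def)

lemma skip_pair_cases:
  obtains "i = a" | "i = Suc a" | i' where "i = skip_pair a i'"
proof -
  have "i = skip_pair a (if i < a then i else i - 2)" if "i \<noteq> a" "i \<noteq> Suc a"
    using that by (auto simp: skip_pair_def)
  then show ?thesis using that by blast
qed

lemma skip_pair_neq: "skip_pair a i \<noteq> a" "skip_pair a i \<noteq> Suc a"
  by (auto simp: skip_pair_def)

lemma inj_skip_chord: "inj (skip_chord a)"
  by (auto simp: inj_def skip_chord_def skip_pair_eq_iff)

lemma balanced_insert_pair: "balanced_from h (insert_pair a U D w) \<longleftrightarrow> balanced_from h w"
  by (simp add: insert_pair_def balanced_from_insert_UD)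

text \<open>The segment enclosed by the two letters is unchanged, or gains a \<open>UD\<close> if
  the insertion falls between them; neither affects balance.\<close>

lemma skip_pair_chord_iff:
  assumes "a \<le> length w"
  shows "(skip_pair a i, skip_pair a j) \<in> chords (insert_pair a U D w) \<longleftrightarrow> (i, j) \<in> chords w"
proof (cases "i < j \<and> j < length w")
  case True
  let ?w = "insert_pair a U D w"
  consider "j < a" | "i < a" "a \<le> j" | "a \<le> i" by linarith
  then have "balanced_from 0 (take (skip_pair a j - Suc (skip_pair a i)) (drop (Suc (skip_pair a i)) ?w))
      \<longleftrightarrow> balanced_from 0 (take (j - Suc i) (drop (Suc i) w))"
  proof cases
    case 1
    then show ?thesis using True assms
      by (simp add: skip_pair_def insert_pair_def take_drop)
  next
    case 2
    have "take (skip_pair a j - Suc (skip_pair a i)) (drop (Suc (skip_pair a i)) ?w) =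
        drop (Suc i) (take a w) @ U # D # take (j - a) (drop a w)"
      using 2 True assms by (simp add: skip_pair_def insert_pair_def take_Cons' Suc_diff_le)
    moreover have "take (j - Suc i) (drop (Suc i) w) =
        drop (Suc i) (take a w) @ take (j - a) (drop a w)"
    proof -
      have "take (j - Suc i) (drop (Suc i) (take a w @ drop a w)) =
          drop (Suc i) (take a w) @ take (j - a) (drop a w)"
        unfolding drop_append take_append using 2 True assms by simp
      then show ?thesis by simp
    qed
    ultimately show ?thesis by (simp add: balanced_from_insert_UD)
  next
    case 3
    have "drop (Suc (skip_pair a i)) ?w = drop (Suc i) w"
      using 3 assms by (simp add: skip_pair_def insert_pair_def Suc_diff_le)
    then show ?thesis using 3 True by (simp add: skip_pair_def)
  qed
  then show ?thesis
    using True assms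
    by (auto simp: mem_chords nth_insert_pair length_insert_pair skip_pair_less_iff)
      (auto simp: skip_pair_def)
next
  case False
  then show ?thesis
    using assms by (auto simp: mem_chords length_insert_pair skip_pair_less_iff skip_pair_def
      split: if_splits)
qed

text \<open>The inserted letters match only each other: with any other partner, the enclosed segment
  would begin with the new \<open>D\<close> or end with the new \<open>U\<close>.\<close>

lemma chords_insert_pair:
  assumes "a \<le> length w"
  shows "chords (insert_pair a U D w) = insert (a, Suc a) (skip_chord a ` chords w)"
proof -
  let ?w = "insert_pair a U D w"
  have "(i, j) \<in> chords ?w \<longleftrightarrow> (i, j) \<in> insert (a, Suc a) (skip_chord a ` chords w)" for i j
  proof (cases "(i, j) = (a, Suc a)")
    case True
    then show ?thesis
      using assms by (simp add: mem_chords nth_insert_pair length_insert_pair)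
  next
    case False
    have img: "(skip_pair a i', skip_pair a j') \<in> skip_chord a ` chords w \<longleftrightarrow> (i', j') \<in> chords w"
      for i' j' by (auto simp: skip_chord_def skip_pair_eq_iff intro!: image_eqI)
    have left: "i' \<noteq> a \<and> i' \<noteq> Suc a \<and> j' \<noteq> a \<and> j' \<noteq> Suc a"
      if "(i', j') \<in> skip_chord a ` chords w" for i' j'
      using that by (auto simp: skip_chord_def dest: sym simp: skip_pair_neq)
    have no: "(i, j) \<notin> chords ?w" if at: "i = a \<or> i = Suc a \<or> j = a \<or> j = Suc a"
    proof
      assume c: "(i, j) \<in> chords ?w"
      then have ij: "i < j" "?w ! i = U" "?w ! j = D"
        and seg: "balanced_from 0 (take (j - Suc i) (drop (Suc i) ?w))"
        by (auto simp: mem_chords)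
      have "i \<noteq> Suc a" "j \<noteq> a"
        using ij nth_insert_pair[OF assms, where x = U and y = D] by auto
      then consider "i = a" "Suc a < j" | "j = Suc a" "i < a"
        using at False ij by fastforce
      then show False
      proof cases
        case 1
        then have "take (j - Suc i) (drop (Suc i) ?w) = D # take (j - Suc (Suc a)) (drop a w)"
          using assms by (simp add: insert_pair_def Suc_diff_le take_Cons')
        with seg show False by simp
      next
        case 2
        then have "take (j - Suc i) (drop (Suc i) ?w) = drop (Suc i) (take a w) @ [U]"
          using assms by (simp add: insert_pair_def Suc_diff_le take_Cons')
        with seg show False by (simp add: not_balanced_from_snoc_U)
      qed
    qed
    show ?thesis
    proof (cases "i = a \<or> i = Suc a \<or> j = a \<or> j = Suc a")
      case True
      then show ?thesis using no left False by blast
    next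
      case out: False
      then obtain i' j' where "i = skip_pair a i'" "j = skip_pair a j'"
        using skip_pair_cases by metis
      then show ?thesis
        using img skip_pair_chord_iff[OF assms] by (simp add: skip_pair_neq)
    qed
  qed
  then show ?thesis by auto
qed


section \<open>Growth sequences and labelings\<close>

lemma growth_sequence_snoc:
  "growth_sequence (Suc n) (p @ [a]) \<longleftrightarrow> growth_sequence n p \<and> a \<le> 2 * n"
  by (auto simp: growth_sequence_def nth_append all_conj_distrib less_Suc_eq)

lemma growth_sequence_induct [consumes 1, case_names Nil snoc]:
  assumes "growth_sequence n p"
    and "P 0 []"
    and "\<And>n p a. growth_sequence n p \<Longrightarrow> a \<le> 2 * n \<Longrightarrow> P n p \<Longrightarrow> P (Suc n) (p @ [a])"
  shows "P n p"
  using assms(1)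
proof (induction p arbitrary: n rule: rev_induct)
  case Nil
  then show ?case using assms(2) by (simp add: growth_sequence_def)
next
  case (snoc a p)
  then obtain m where "n = Suc m" by (cases n) (auto simp: growth_sequence_def)
  then show ?case using snoc assms(3) by (simp add: growth_sequence_snoc)
qed

lemma length_grow_upto: "length (grow_upto p i) = 2 * i"
  by (induction i) simp_all

lemma grow_upto_append: "i \<le> length p \<Longrightarrow> grow_upto (p @ q) i = grow_upto p i"
  by (induction i) (simp_all add: nth_append)

lemma grow_upto_snoc:
  "grow_upto (p @ [a]) (length (p @ [a])) =
     insert_pair a (U, Suc (length p)) (D, Suc (length p)) (grow_upto p (length p))"
  by (simp add: grow_upto_append insert_pair_def)

lemma length_grow_path: "length (grow_path p) = 2 * length p"
  by (simp add: grow_path_def length_grow_upto)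

lemma grow_path_snoc: "grow_path (p @ [a]) = insert_pair a U D (grow_path p)"
  unfolding grow_path_def grow_upto_snoc by (simp add: insert_pair_def take_map drop_map)

lemma grow_labeling_snoc:
  assumes "a \<le> 2 * length p"
  shows "grow_labeling (p @ [a]) (a, j) = Suc (length p)"
    and "c \<in> chords (grow_path p) \<Longrightarrow>
      grow_labeling (p @ [a]) (skip_chord a c) = grow_labeling p c"
proof -
  show "grow_labeling (p @ [a]) (a, j) = Suc (length p)"
    unfolding grow_labeling_def grow_upto_snoc
    using assms by (simp add: nth_insert_pair length_grow_upto)
  assume "c \<in> chords (grow_path p)"
  then have "fst c < length (grow_upto p (length p))"
    by (cases c) (auto simp: mem_chords length_grow_path length_grow_upto)
  then show "grow_labeling (p @ [a]) (skip_chord a c) = grow_labeling p c"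
    unfolding grow_labeling_def grow_upto_snoc
    using assms by (simp add: nth_insert_pair length_grow_upto skip_chord_def)
qed

lemma chords_grow_path_snoc:
  "a \<le> 2 * length p \<Longrightarrow>
    chords (grow_path (p @ [a])) = insert (a, Suc a) (skip_chord a ` chords (grow_path p))"
  by (simp add: grow_path_snoc chords_insert_pair length_grow_path)

lemma bij_betw_grow_labeling:
  "growth_sequence n p \<Longrightarrow> bij_betw (grow_labeling p) (chords (grow_path p)) {1..n}"
proof (induction rule: growth_sequence_induct)
  case Nil
  then show ?case by (simp add: grow_path_def chords_def bij_betw_def)
next
  case (snoc n p a)
  then have len: "length p = n" by (simp add: growth_sequence_def)
  have inj: "inj_on (grow_labeling p) (chords (grow_path p))"
    and img: "grow_labeling p ` chords (grow_path p) = {1..n}"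
    using snoc.IH by (auto simp: bij_betw_def)
  have "grow_labeling (p @ [a]) ` skip_chord a ` chords (grow_path p) = {1..n}"
    unfolding image_image using snoc.hyps img len by (simp add: grow_labeling_snoc)
  moreover have "inj_on (grow_labeling (p @ [a]) \<circ> skip_chord a) (chords (grow_path p))"
    using snoc.hyps inj len unfolding inj_on_def comp_def
    by (metis grow_labeling_snoc(2))
  then have "inj_on (grow_labeling (p @ [a])) (skip_chord a ` chords (grow_path p))"
    by (rule inj_on_imageI)
  ultimately have bij: "bij_betw (grow_labeling (p @ [a])) (skip_chord a ` chords (grow_path p)) {1..n}"
    by (simp add: bij_betw_def)
  have last: "grow_labeling (p @ [a]) (a, Suc a) = Suc n"
    using snoc.hyps len by (simp add: grow_labeling_snoc)
  then have "(a, Suc a) \<notin> skip_chord a ` chords (grow_path p)"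
    using bij_betwE[OF bij] by fastforce
  with notIn_Un_bij_betw[OF this _ bij] last show ?case
    using snoc.hyps len by (simp add: chords_grow_path_snoc atLeastAtMostSuc_conv)
qed

text \<open>\<open>L0\<close> sees only the position of the up step. Injectivity of
  \<open>fst\<close> is what later lets equal ranks identify chords.\<close>

lemma inj_on_fst_chords_grow_path:
  "growth_sequence n p \<Longrightarrow> inj_on fst (chords (grow_path p))"
proof (induction rule: growth_sequence_induct)
  case Nil
  then show ?case by (simp add: grow_path_def chords_def)
next
  case (snoc n p a)
  have "inj_on (fst \<circ> skip_chord a) (chords (grow_path p))"
    using snoc.IH by (simp add: inj_on_def skip_chord_def skip_pair_eq_iff)
  then have "inj_on fst (skip_chord a ` chords (grow_path p))"
    by (rule inj_on_imageI)
  moreover have "a \<notin> fst ` skip_chord a ` chords (grow_path p)"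
    by (auto simp: skip_chord_def dest: sym simp: skip_pair_neq)
  ultimately have "inj_on fst (insert (a, Suc a) (skip_chord a ` chords (grow_path p)))"
    by (simp add: inj_on_insert) blast
  then show ?case
    using snoc.hyps by (simp add: chords_grow_path_snoc growth_sequence_def)
qed

text \<open>The largest label reveals the latest insertion, which allows growth to be undone one
  entry at a time.\<close>

lemma chord_with_last_label:
  assumes "growth_sequence (Suc n) (p @ [a])" "c \<in> chords (grow_path (p @ [a]))"
  shows "grow_labeling (p @ [a]) c = Suc n \<longleftrightarrow> c = (a, Suc a)"
proof -
  have p: "growth_sequence n p" "a \<le> 2 * length p" "length p = n"
    using assms(1) by (auto simp: growth_sequence_snoc) (auto simp: growth_sequence_def)
  have "grow_labeling p c' \<le> n" if "c' \<in> chords (grow_path p)" for c'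
    using bij_betwE[OF bij_betw_grow_labeling[OF p(1)]] that by fastforce
  then show ?thesis
    using assms(2) p grow_labeling_snoc[OF p(2)]
    by (fastforce simp: chords_grow_path_snoc skip_chord_def skip_pair_neq)
qed

section \<open>Descents read off the growth sequence\<close>

text \<open>Later insertions preserve the order of up steps, so only the moment when label
  \<open>i + 2\<close> is inserted matters.\<close>

lemma chord_order_iff_growth_order:
  assumes "growth_sequence n p" "c \<in> chords (grow_path p)" "c' \<in> chords (grow_path p)"
    and "grow_labeling p c = Suc i" "grow_labeling p c' = Suc (Suc i)"
  shows "fst c' < fst c \<longleftrightarrow> p ! Suc i \<le> p ! i"
  using assms
proof (induction arbitrary: c c' i rule: growth_sequence_induct)
  case Nil
  then show ?case by (simp add: grow_path_def chords_def)
next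
  case (snoc n p a)
  have len: "length p = n" using snoc.hyps by (simp add: growth_sequence_def)
  have gs: "growth_sequence (Suc n) (p @ [a])" using snoc.hyps by (simp add: growth_sequence_snoc)
  have "Suc (Suc i) \<le> Suc n"
    using bij_betwE[OF bij_betw_grow_labeling[OF gs]] snoc.prems by fastforce
  have old: "\<exists>d\<in>chords (grow_path p). e = skip_chord a d \<and> grow_labeling p d = grow_labeling (p @ [a]) e"
    if "e \<in> chords (grow_path (p @ [a]))" "grow_labeling (p @ [a]) e \<noteq> Suc n" for e
    using that snoc.hyps len chord_with_last_label[OF gs that(1)]
    by (auto simp: chords_grow_path_snoc grow_labeling_snoc)
  obtain d where d: "d \<in> chords (grow_path p)" "c = skip_chord a d" "grow_labeling p d = Suc i"
    using old[of c] snoc.prems \<open>Suc (Suc i) \<le> Suc n\<close> by auto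
  show ?case
  proof (cases "Suc i = n")
    case True
    then obtain q b where q: "p = q @ [b]" "length q = i"
      using len by (metis length_Suc_conv_rev)
    have "fst d = b"
      using chord_with_last_label[of i q b d] snoc.hyps(1) True d q by simp
    moreover have "c' = (a, Suc a)"
      using chord_with_last_label[OF gs, of c'] snoc.prems True by simp
    \<comment> \<open>The older up step was at \<open>b\<close> and is now at
      \<open>skip_pair a b\<close>, which exceeds \<open>a\<close> exactly if
      \<open>a \<le> b\<close>: an insertion at the same place goes to its left.\<close>
    ultimately show ?thesis
      using d q len True by (auto simp: skip_chord_def skip_pair_def nth_append)
  next
    case False
    then obtain d' where "d' \<in> chords (grow_path p)" "c' = skip_chord a d'"
        "grow_labeling p d' = Suc (Suc i)"
      using old[of c'] snoc.prems by auto
    then show ?thesis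
      using snoc.IH[of d d' i] d False \<open>Suc (Suc i) \<le> Suc n\<close> len
      by (simp add: skip_chord_def skip_pair_less_iff nth_append)
  qed
qed

lemma L0_less_iff:
  assumes "c \<in> chords w" "c' \<in> chords w"
  shows "L0 w c < L0 w c' \<longleftrightarrow> fst c < fst c'"
proof
  assume less: "fst c < fst c'"
  then have "c' \<in> {d \<in> chords w. fst d \<le> fst c'} - {d \<in> chords w. fst d \<le> fst c}"
    using assms by simp
  then have "{d \<in> chords w. fst d \<le> fst c} \<subset> {d \<in> chords w. fst d \<le> fst c'}"
    using less by (intro psubsetI subsetI) (simp, blast)
  then show "L0 w c < L0 w c'"
    unfolding L0_def by (intro psubset_card_mono) (simp_all add: finite_chords)
next
  assume less: "L0 w c < L0 w c'"
  show "fst c < fst c'"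
  proof (rule ccontr)
    assume "\<not> fst c < fst c'"
    then have "L0 w c' \<le> L0 w c"
      unfolding L0_def by (intro card_mono) (auto simp: finite_chords)
    with less show False by simp
  qed
qed

text \<open>The values of the permutation rank the up steps, so a descent at \<open>j + 1\<close>
  says that the chord labeled \<open>j + 2\<close> starts left of the one labeled
  \<open>j + 1\<close>.\<close>

lemma des_labeling_perm_grow:
  assumes "growth_sequence n p"
  shows "des n (labeling_perm n (grow_path p) (grow_labeling p)) =
    card {j. Suc j < n \<and> p ! Suc j \<le> p ! j}"
proof -
  let ?w = "grow_path p" and ?\<sigma> = "labeling_perm n (grow_path p) (grow_labeling p)"
  let ?c = "inv_into (chords (grow_path p)) (grow_labeling p)"
  have c: "?c i \<in> chords ?w" "grow_labeling p (?c i) = i" if "i \<in> {1..n}" for i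
    using bij_betw_grow_labeling[OF assms] that
    by (auto simp: bij_betw_def inv_into_into f_inv_into_f)
  have *: "?\<sigma> (Suc j) > ?\<sigma> (Suc (Suc j)) \<longleftrightarrow> p ! Suc j \<le> p ! j" if "Suc j < n" for j
    using that c[of "Suc j"] c[of "Suc (Suc j)"]
    by (simp add: labeling_perm_def L0_less_iff chord_order_iff_growth_order[OF assms, where i = j])
  have "{i. 1 \<le> i \<and> i < n \<and> ?\<sigma> i > ?\<sigma> (i + 1)} = Suc ` {j. Suc j < n \<and> p ! Suc j \<le> p ! j}"
  proof (rule set_eqI)
    fix i
    show "i \<in> {i. 1 \<le> i \<and> i < n \<and> ?\<sigma> i > ?\<sigma> (i + 1)} \<longleftrightarrow>
        i \<in> Suc ` {j. Suc j < n \<and> p ! Suc j \<le> p ! j}"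
      using * by (cases i) auto
  qed
  then show ?thesis
    by (simp add: des_def card_image)
qed

section \<open>Uniqueness and existence of the growth sequence\<close>

text \<open>Equal permutations give the chords with a common label under \<open>L\<close> and
  \<open>L'\<close> the same rank, hence the same up step, hence they coincide.\<close>

lemma labeling_perm_eqD:
  assumes "bij_betw L (chords w) {1..n}" "bij_betw L' (chords w) {1..n}"
    and "inj_on fst (chords w)"
    and "labeling_perm n w L = labeling_perm n w L'"
    and "c \<in> chords w"
  shows "L c = L' c"
proof -
  have Lc: "L c \<in> {1..n}" "inv_into (chords w) L (L c) = c"
    using assms(1,5) by (auto simp: bij_betw_def inv_into_f_f)
  define c' where "c' = inv_into (chords w) L' (L c)"
  have c': "c' \<in> chords w" "L' c' = L c"
    using assms(2) Lc(1) by (auto simp: c'_def bij_betw_def inv_into_into f_inv_into_f)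
  have "L0 w c = L0 w c'"
    using fun_cong[OF assms(4), of "L c"] Lc by (simp add: labeling_perm_def c'_def)
  then have "fst c = fst c'"
    using L0_less_iff[OF assms(5) c'(1)] L0_less_iff[OF c'(1) assms(5)] by simp
  then show ?thesis
    using assms(3,5) c' by (metis inj_onD)
qed

lemma insert_pair_inject:
  assumes "insert_pair a x y v = insert_pair a x' y' w" "a \<le> length v" "a \<le> length w"
  shows "v = w"
proof -
  have "take a v = take a w" "drop a v = drop a w"
    using assms by (auto simp: insert_pair_def append_eq_append_conv)
  then show ?thesis by (metis append_take_drop_id)
qed

text \<open>The chord with the largest label determines the last entry; removing it from both words
  reduces to shorter sequences.\<close>

lemma grow_path_labeling_inject:
  assumes "growth_sequence n p" "growth_sequence n q" "grow_path p = grow_path q"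
    and "\<And>c. c \<in> chords (grow_path p) \<Longrightarrow> grow_labeling p c = grow_labeling q c"
  shows "p = q"
  using assms
proof (induction arbitrary: q rule: growth_sequence_induct)
  case Nil
  then show ?case by (simp add: growth_sequence_def)
next
  case (snoc n p a)
  obtain q' b where q: "q = q' @ [b]"
    using snoc.prems(1) by (cases q rule: rev_cases) (auto simp: growth_sequence_def)
  have gs: "growth_sequence (Suc n) (p @ [a])" "growth_sequence (Suc n) (q' @ [b])"
    using snoc.hyps snoc.prems q by (auto simp: growth_sequence_snoc)
  then have q': "growth_sequence n q'" "b \<le> 2 * n" by (auto simp: growth_sequence_snoc)
  have len: "length p = n" "length q' = n"
    using snoc.hyps q' by (auto simp: growth_sequence_def)
  have mem: "(a, Suc a) \<in> chords (grow_path (p @ [a]))"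
    using snoc.hyps len by (simp add: chords_grow_path_snoc)
  then have "grow_labeling (q' @ [b]) (a, Suc a) = Suc n"
    using snoc.prems(3)[OF mem] chord_with_last_label[OF gs(1) mem] q by simp
  then have ab: "b = a"
    using chord_with_last_label[OF gs(2)] mem snoc.prems(2) q by auto
  have paths: "grow_path p = grow_path q'"
    using snoc.prems(2) snoc.hyps q' len
    by (auto simp: q ab grow_path_snoc length_grow_path intro: insert_pair_inject)
  have "grow_labeling p c = grow_labeling q' c" if "c \<in> chords (grow_path p)" for c
    using snoc.prems(3)[of "skip_chord a c"] that snoc.hyps len q ab
      grow_labeling_snoc(2)[of a p c] grow_labeling_snoc(2)[of a q' c]
    by (simp add: chords_grow_path_snoc paths)
  then show ?case
    using snoc.IH[OF q'(1) paths] q ab by simp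
qed

text \<open>The chord with the largest label encloses no other chord, so it is a peak. Deleting this
  peak leaves a Dyck path with a natural labeling, and reinserting it is the last growth
  step.\<close>

lemma natural_labeling_grows:
  assumes "dyck_path n w" "natural_labeling n w L"
  shows "\<exists>p. growth_sequence n p \<and> grow_path p = w \<and> (\<forall>c\<in>chords w. grow_labeling p c = L c)"
  using assms
proof (induction n arbitrary: w L)
  case 0
  then have "w = []" by (simp add: dyck_path_def)
  then show ?case
    by (auto intro!: exI[of _ "[]"] simp: growth_sequence_def grow_path_def chords_def)
next
  case (Suc n)
  have bij: "bij_betw L (chords w) {1..Suc n}"
    using Suc.prems by (simp add: natural_labeling_def)
  then obtain i j where c: "(i, j) \<in> chords w" "L (i, j) = Suc n"
    unfolding bij_betw_def by (metis atLeastAtMost_iff imageE le_add1 order_refl plus_1_eq_Suc surj_pair)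
  let ?seg = "take (j - Suc i) (drop (Suc i) w)"
  have ij: "i < j" "j < length w" "w ! i = U" "w ! j = D" "balanced_from 0 ?seg"
    using c by (auto simp: mem_chords)
  \<comment> \<open>A nonempty balanced segment contains a peak, that is, an enclosed chord, whose
    label would have to exceed \<open>Suc n\<close>.\<close>
  have "?seg = []"
  proof (rule ccontr)
    assume "?seg \<noteq> []"
    then obtain u v where uv: "?seg = u @ U # D # v"
      using balanced_peak ij(5) by blast
    let ?k = "Suc i + length u"
    have "length ?seg = length u + 2 + length v" using uv by simp
    then have k: "Suc ?k < j" using ij by simp
    have "w ! (Suc i + m) = ?seg ! m" if "m < j - Suc i" for m
      using that ij by simp
    from this[of "length u"] this[of "Suc (length u)"] have "w ! ?k = U" "w ! Suc ?k = D"
      using k by (simp_all add: uv nth_append)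
    then have k_chord: "(?k, Suc ?k) \<in> chords w"
      using k ij by (simp add: mem_chords)
    moreover have "chord_less (i, j) (?k, Suc ?k)"
      using k by (simp add: chord_less_def)
    ultimately have "L (i, j) < L (?k, Suc ?k)"
      using Suc.prems(2) c(1) unfolding natural_labeling_def by blast
    moreover have "L (?k, Suc ?k) \<le> Suc n"
      using bij_betwE[OF bij] k_chord by fastforce
    ultimately show False using c by simp
  qed
  then have j: "j = Suc i" using ij by simp
  define v where "v = take i w @ drop (i + 2) w"
  have i: "i \<le> length v" using ij by (simp add: v_def)
  have "drop i w = U # D # drop (i + 2) w"
    using ij j by (metis Cons_nth_drop_Suc Suc_lessD add_2_eq_Suc')
  then have w: "w = insert_pair i U D v"
    using ij by (simp add: v_def insert_pair_def) (metis append_take_drop_id)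
  have len: "length v = 2 * n" and dyck: "dyck_path n v"
    using Suc.prems(1) w
    by (simp_all add: dyck_path_iff_balanced length_insert_pair balanced_insert_pair)
  have chords_w: "chords w = insert (i, Suc i) (skip_chord i ` chords v)"
    using chords_insert_pair[OF i] w by simp
  have new: "(i, Suc i) \<notin> skip_chord i ` chords v"
    by (auto simp: skip_chord_def dest: sym simp: skip_pair_neq)
  have "bij_betw L (skip_chord i ` chords v) {1..n}"
  proof -
    have "chords w - {(i, j)} = skip_chord i ` chords v" "{1..Suc n} - {Suc n} = {1..n}"
      using chords_w new j by auto
    then show ?thesis
      using bij_betw_DiffI[OF bij, of "{(i, j)}" "{Suc n}"] c by (simp add: bij_betw_def)
  qed
  moreover have "bij_betw (skip_chord i) (chords v) (skip_chord i ` chords v)"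
    using inj_on_subset[OF inj_skip_chord subset_UNIV] by (simp add: bij_betw_def)
  ultimately have "bij_betw (L \<circ> skip_chord i) (chords v) {1..n}"
    by (rule bij_betw_trans[rotated])
  moreover have "(L \<circ> skip_chord i) c < (L \<circ> skip_chord i) c'"
    if "c \<in> chords v" "c' \<in> chords v" "chord_less c c'" for c c'
    using Suc.prems(2) that chords_w
    by (auto simp: natural_labeling_def chord_less_def skip_chord_def skip_pair_less_iff)
  ultimately have "natural_labeling n v (L \<circ> skip_chord i)"
    by (simp add: natural_labeling_def)
  from Suc.IH[OF dyck this] obtain p where
    p: "growth_sequence n p" "grow_path p = v" "\<forall>c\<in>chords v. grow_labeling p c = L (skip_chord i c)"
    by auto
  have len_p: "length p = n" using p by (simp add: growth_sequence_def)
  have "growth_sequence (Suc n) (p @ [i])" "grow_path (p @ [i]) = w"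
    using p i len w by (simp_all add: growth_sequence_snoc grow_path_snoc)
  moreover have "\<forall>c\<in>chords w. grow_labeling (p @ [i]) c = L c"
    using p len_p i len c j grow_labeling_snoc[of i p] by (auto simp: chords_w)
  ultimately show ?case by blast
qed

text \<open>Existence and uniqueness together make the definite description in
  \<open>growth_of\<close> denote a sequence with the intended properties.\<close>

lemma growth_of_linear_extension:
  assumes "dyck_path n w" "\<sigma> \<in> linear_extensions n w"
  shows "growth_sequence n (growth_of n w \<sigma>) \<and> grow_path (growth_of n w \<sigma>) = w \<and>
    labeling_perm n w (grow_labeling (growth_of n w \<sigma>)) = \<sigma>"
proof -
  from assms(2) obtain L where L: "natural_labeling n w L" "\<sigma> = labeling_perm n w L"
    by (auto simp: linear_extensions_def)
  obtain p where p: "growth_sequence n p" "grow_path p = w" "\<forall>c\<in>chords w. grow_labeling p c = L c"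
    using natural_labeling_grows[OF assms(1) L(1)] by blast
  \<comment> \<open>The labelings agree only on chords, which suffices because
    \<open>inv_into\<close> inspects only values on the given set.\<close>
  have "inv_into (chords w) (grow_labeling p) = inv_into (chords w) L"
    using p(3) by (auto simp: inv_into_def fun_eq_iff intro!: arg_cong[where f = Eps])
  then have \<sigma>: "labeling_perm n w (grow_labeling p) = \<sigma>"
    by (simp add: L(2) labeling_perm_def fun_eq_iff)
  have "q = p" if q: "growth_sequence n q" "grow_path q = w"
    "labeling_perm n w (grow_labeling q) = \<sigma>" for q
  proof (rule grow_path_labeling_inject[OF q(1) p(1)])
    show "grow_path q = grow_path p" using p q by simp
    show "grow_labeling q c = grow_labeling p c" if "c \<in> chords (grow_path q)" for c
      using labeling_perm_eqD[of "grow_labeling q" w n "grow_labeling p" c]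
        bij_betw_grow_labeling[OF q(1)] bij_betw_grow_labeling[OF p(1)]
        inj_on_fst_chords_grow_path[OF p(1)] that p(2) q(2,3) \<sigma> by simp
  qed
  then have "growth_of n w \<sigma> = p"
    unfolding growth_of_def using p(1,2) \<sigma> by (intro the_equality) blast+
  then show ?thesis
    using p(1,2) \<sigma> by simp
qed

theorem theorem6:
  fixes n :: nat and lam :: "step list" and \<sigma> :: "nat \<Rightarrow> nat"
  assumes "dyck_path n lam"
    and "\<sigma> \<in> linear_extensions n lam"
  shows "dis (DTR n lam \<sigma>) = des n \<sigma>"
proof -
  let ?p = "growth_of n lam \<sigma>"
  have p: "growth_sequence n ?p" "grow_path ?p = lam"
    "labeling_perm n lam (grow_labeling ?p) = \<sigma>"
    using growth_of_linear_extension[OF assms] by auto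
  have "dis (DTR n lam \<sigma>) = card {j. Suc j < n \<and> ?p ! Suc j \<le> ?p ! j}"
    unfolding DTR_def by (rule dis_DTR_growth[OF p(1)])
  also have "\<dots> = des n (labeling_perm n (grow_path ?p) (grow_labeling ?p))"
    by (rule des_labeling_perm_grow[OF p(1), symmetric])
  finally show ?thesis
    by (simp only: p)
qed

end
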